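(* For every $n\geq 1$, $$B_{2n+2} = \{0\}\cup\{\phi(b)0 : b\in B_{2n+1}\},\qquad B_{2n+3} = \{0^{-1}\phi(b) : b\in B_{2n+2}\},$$ and $B_3=\{1,11\}$.
   Context: Let $\phi$ be the morphism on $\{0,1\}^*$ with $\phi(0)=01$, $\phi(1)=0$. Finite Fibonacci words: $f_1=1$, $f_2=0$, $f_{n+2}=f_{n+1}f_n$. For $n\geq 3$, $p_n$ is $f_n$ with its last two letters deleted ($p_3=\epsilon$, $p_4=0$, $p_5=010$, ...). The minimal forbidden factors of the infinite Fibonacci word are $M_{2n+1}=1p_{2n+1}1$ and $M_{2n+2}=0p_{2n+2}0$ for $n\geq 1$ (so $M_3=11$, $M_4=000$, $M_5=10101$). A word $b$ is a border of $w$ if $w=xb=by$ for some words $x,y$. For $n\geq 3$, $B_n$ is the set of all nonempty borders of $M_n$. For a word $w$ beginning with $0$, $0^{-1}w$ denotes $w$ with its first letter removed. *)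

theory Defs
  imports Main
begin

datatype letter = Zero | One

type_synonym word = "letter list"

primrec phi_letter :: "letter \<Rightarrow> word" where
  "phi_letter Zero = [Zero, One]"
| "phi_letter One = [Zero]"

definition phi :: "word \<Rightarrow> word" where
  "phi w = concat (map phi_letter w)"

text \<open>The sequence of finite Fibonacci words starts at index 1; the value at 0 is arbitrary.\<close>

fun fib_word :: "nat \<Rightarrow> word" where
  "fib_word 0 = []"
| "fib_word (Suc 0) = [One]"
| "fib_word (Suc (Suc 0)) = [Zero]"
| "fib_word (Suc (Suc (Suc n))) = fib_word (Suc (Suc n)) @ fib_word (Suc n)"

text \<open>The words below are only meant for indices \<open>n \<ge> 3\<close>.\<close>

definition p_word :: "nat \<Rightarrow> word" where
  "p_word n = butlast (butlast (fib_word n))"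

definition M_word :: "nat \<Rightarrow> word" where
  "M_word n = (if odd n then [One] @ p_word n @ [One] else [Zero] @ p_word n @ [Zero])"

text \<open>The words \<open>x\<close> and \<open>y\<close> may be empty, so every word is a border of itself.\<close>

definition border :: "word \<Rightarrow> word \<Rightarrow> bool" where
  "border b w \<longleftrightarrow> (\<exists>x y. w = x @ b \<and> w = b @ y)"

definition border_set :: "nat \<Rightarrow> word set" where
  "border_set n = {b. b \<noteq> [] \<and> border b (M_word n)}"

text \<open>The word \<open>0\<inverse>w\<close>, only meant for \<open>w\<close> beginning with \<open>0\<close>. It is applied to words
  \<open>phi b\<close> with \<open>b\<close> nonempty, which do begin with \<open>0\<close> by the lemma below.\<close>

definition remove_zero :: "word \<Rightarrow> word" where
  "remove_zero w = tl w"

lemma phi_begins_with_zero: "b \<noteq> [] \<Longrightarrow> phi b = Zero # remove_zero (phi b)"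
proof (cases b)
  case (Cons a c)
  then show ?thesis by (cases a) (simp_all add: phi_def remove_zero_def)
qed simp

lemma M_word_examples:
  "M_word 3 = [One, One]"
  "M_word 4 = [Zero, Zero, Zero]"
  "M_word 5 = [One, Zero, One, Zero, One]"
  by (simp_all add: M_word_def) (simp_all add: p_word_def numeral_eq_Suc)

end

theory Submission imports Defs
begin

text \<open>The image \<open>\<phi>(w)\<close> splits uniquely into blocks \<open>0\<close> and \<open>01\<close>, and it can be cut exactly in
  front of its letters \<open>0\<close>. Since \<open>p\<^sub>n\<^sub>+\<^sub>1 = \<phi>(p\<^sub>n)0\<close>, we have \<open>M\<^sub>2\<^sub>n\<^sub>+\<^sub>2 = \<phi>(M\<^sub>2\<^sub>n\<^sub>+\<^sub>1)0\<close> and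
  \<open>M\<^sub>2\<^sub>n\<^sub>+\<^sub>3 = 0\<inverse>\<phi>(M\<^sub>2\<^sub>n\<^sub>+\<^sub>2)\<close>. A border of such a word, after removing the final \<open>0\<close> or restoring
  the initial \<open>0\<close>, has its ends at admissible cuts, hence is the image of a border.\<close>

section \<open>Unique decomposition of images under \<open>phi\<close>\<close>

lemma phi_Nil [simp]: "phi [] = []"
  by (simp add: phi_def)

lemma phi_Cons [simp]: "phi (a # w) = phi_letter a @ phi w"
  by (simp add: phi_def)

lemma phi_append [simp]: "phi (u @ v) = phi u @ phi v"
  by (simp add: phi_def)

lemma phi_eq_Nil_iff [simp]: "phi w = [] \<longleftrightarrow> w = []"
  by (cases w; cases "hd w") auto

lemma phi_neq_One_Cons [simp]: "phi w \<noteq> One # y"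
  using phi_begins_with_zero[of w] by (cases w) auto

text \<open>Whether a \<open>One\<close> follows the leading \<open>Zero\<close> decides the first
  letter of the preimage, since no image begins with \<open>One\<close>.\<close>

lemma inj_phi: "phi u = phi v \<Longrightarrow> u = v"
proof (induction u arbitrary: v)
  case Nil
  then have "phi v = []" by simp
  then show ?case by simp
next
  case (Cons a u)
  then obtain b v' where v: "v = b # v'"
    by (cases v; cases a) auto
  show ?case
    using Cons v phi_neq_One_Cons[of u] phi_neq_One_Cons[of v', symmetric]
    by (cases a; cases b) auto
qed

text \<open>The only cut inside a block splits \<open>[Zero, One]\<close> and leaves
  \<open>One\<close> at the head of \<open>y\<close>, which the second assumption excludes.\<close>

lemma phi_cut:
  assumes "phi w = x @ y" and "y = [] \<or> hd y = Zero"
  obtains u v where "w = u @ v" "phi u = x" "phi v = y"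
proof -
  have "\<exists>u v. w = u @ v \<and> phi u = x \<and> phi v = y"
    using assms(1)
  proof (induction w arbitrary: x)
    case Nil
    then show ?case by simp
  next
    case (Cons a w)
    show ?case
    proof (cases x)
      case Nil
      then have "a # w = [] @ (a # w) \<and> phi [] = x \<and> phi (a # w) = y"
        using Cons.prems by simp
      then show ?thesis by blast
    next
      case x: (Cons b x')
      have "\<exists>z. x = phi_letter a @ z \<and> phi w = z @ y"
        using Cons.prems x assms(2) by (cases a; cases x') auto
      then obtain z where z: "x = phi_letter a @ z" "phi w = z @ y" by blast
      from Cons.IH[OF z(2)] obtain u v where "w = u @ v" "phi u = z" "phi v = y" by blast
      with z(1) have "a # w = (a # u) @ v \<and> phi (a # u) = x \<and> phi v = y" by simp
      then show ?thesis by blast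
    qed
  qed
  then show ?thesis using that by blast
qed

lemma phi_Zero_before_One:
  assumes "phi w = x @ One # y"
  obtains x' where "x = x' @ [Zero]"
proof -
  have "\<exists>x'. x = x' @ [Zero]"
    using assms
  proof (induction w arbitrary: x)
    case Nil
    then show ?case by simp
  next
    case (Cons a w)
    show ?case
    \<comment> \<open>For any other \<open>x\<close> the displayed \<open>One\<close> lies beyond
      the first block, so \<open>x\<close> contains that block entirely.\<close>
    proof (cases "x = [Zero]")
      case False
      then have "\<exists>z. x = phi_letter a @ z \<and> phi w = z @ One # y"
        using Cons.prems by (cases a; cases x; cases "tl x") auto
      then show ?thesis using Cons.IH by auto
    qed simp
  qed
  then show ?thesis using that by blast
qed

section \<open>Borders of images under \<open>phi\<close>\<close>

lemma border_phi_of_cuts: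
  assumes "phi w = x @ c" "phi w = c @ y" "hd c = Zero" "y = [] \<or> hd y = Zero"
  obtains b where "border b w" "phi b = c"
proof -
  obtain u b where b: "w = u @ b" "phi b = c"
    using phi_cut[OF assms(1)] assms(3) by blast
  obtain b' v where b': "w = b' @ v" "phi b' = c"
    using phi_cut[OF assms(2,4)] by blast
  \<comment> \<open>Injectivity makes the preimages of the suffix and the prefix \<open>c\<close>
    one and the same word.\<close>
  have "b' = b" using b(2) b'(2) inj_phi by simp
  then show ?thesis using b b' that unfolding border_def by blast
qed

lemma nonempty_borders_phi_Zero:
  "{c. c \<noteq> [] \<and> border c (phi w @ [Zero])} =
    {[Zero]} \<union> {phi b @ [Zero] | b. b \<noteq> [] \<and> border b w}" (is "?L = ?R")
proof (intro equalityI subsetI)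
  fix c assume "c \<in> ?L"
  then obtain x y where c: "c \<noteq> []" "phi w @ [Zero] = x @ c" "phi w @ [Zero] = c @ y"
    unfolding border_def by blast
  obtain c' where c': "c = c' @ [Zero]" and x: "phi w = x @ c'"
    using c(1,2) by (cases c rule: rev_cases) auto
  \<comment> \<open>If \<open>y\<close> is empty, so is \<open>z\<close>; otherwise \<open>z\<close>
    begins with the \<open>Zero\<close> that ends \<open>c\<close>, and the appended
    \<open>Zero\<close> is the last letter of \<open>y\<close>.\<close>
  have "\<exists>z. phi w = c' @ z \<and> (z = [] \<or> hd z = Zero)"
    using c(3) c' by (cases y rule: rev_cases) auto
  then obtain z where z: "phi w = c' @ z" "z = [] \<or> hd z = Zero" by blast
  show "c \<in> ?R"
  proof (cases "c' = []")
    case True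
    then show ?thesis using c' by simp
  next
    case False
    then have "hd c' = Zero"
      using z(1) phi_begins_with_zero[of w] by (cases w; cases c') auto
    then obtain b where "border b w" "phi b = c'"
      using border_phi_of_cuts[OF x z(1) _ z(2)] by blast
    then show ?thesis using False c' by auto
  qed
next
  fix c assume "c \<in> ?R"
  then consider "c = [Zero]" | b where "c = phi b @ [Zero]" "border b w" by blast
  then show "c \<in> ?L"
  proof cases
    case 1
    have "\<exists>y. phi w @ [Zero] = [Zero] @ y"
      using phi_begins_with_zero[of w] by (cases "w = []") (auto, metis append_Cons)
    then show ?thesis using 1 unfolding border_def by blast
  next
    case 2
    from 2(2) obtain x y where w: "w = x @ b" "w = b @ y"
      unfolding border_def by blast
    \<comment> \<open>The \<open>Zero\<close> after the prefix \<open>phi b\<close> opens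
      \<open>phi y\<close>, or is the appended letter if \<open>y\<close> is empty.\<close>
    have "\<exists>z. phi y @ [Zero] = [Zero] @ z"
      using phi_begins_with_zero[of y] by (cases "y = []") (auto, metis append_Cons)
    then obtain z where "phi y @ [Zero] = [Zero] @ z" by blast
    then have "phi w @ [Zero] = c @ z" using w(2) 2(1) by simp
    moreover have "phi w @ [Zero] = phi x @ c" using w(1) 2(1) by simp
    ultimately show ?thesis using 2(1) unfolding border_def by blast
  qed
qed

text \<open>As \<open>w\<close> begins and ends with \<open>Zero\<close>, the shortened image begins
  and ends with \<open>One\<close>, and so does each of its nonempty borders. Hence a
  \<open>Zero\<close> precedes each occurrence of the border in \<open>phi w\<close>, and no
  \<open>One\<close> follows.\<close>

lemma nonempty_borders_remove_zero_phi:
  assumes "hd w = Zero" "last w = Zero" "w \<noteq> []"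
  shows "{c. c \<noteq> [] \<and> border c (remove_zero (phi w))} =
    {remove_zero (phi b) | b. b \<noteq> [] \<and> border b w}" (is "?L = ?R")
proof (intro equalityI subsetI)
  have w0: "phi w = Zero # remove_zero (phi w)"
    using phi_begins_with_zero assms(3) .
  fix c assume "c \<in> ?L"
  then obtain x y where c: "c \<noteq> []" "remove_zero (phi w) = x @ c" "remove_zero (phi w) = c @ y"
    unfolding border_def by blast
  obtain d where "remove_zero (phi w) = One # d"
    using assms(1,3) by (cases w) (auto simp: remove_zero_def)
  then obtain c1 where c1: "c = One # c1"
    using c(1,3) by (cases c) auto
  have "last (phi w) = One"
    using assms(2,3) by (cases w rule: rev_cases) auto
  moreover have "last (phi w) = last c"
    using c(1,2) w0 by (metis append_Cons last_appendR)
  ultimately obtain c2 where c2: "c = c2 @ [One]"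
    using c(1) by (metis append_butlast_last_id)
  \<comment> \<open>The \<open>Zero\<close> before the suffix \<open>c\<close> is the last letter of
    \<open>x\<close>, or the deleted letter if \<open>x\<close> is empty.\<close>
  have "phi w = (Zero # x) @ One # c1" using w0 c(2) c1 by simp
  then obtain x' where "Zero # x = x' @ [Zero]" using phi_Zero_before_One by blast
  then have x': "phi w = x' @ (Zero # c)"
    using w0 c(2) by (metis append.assoc append_Cons append_Nil)
  have y: "phi w = (Zero # c) @ y" using w0 c(3) by simp
  have "y = [] \<or> hd y = Zero"
  proof (rule ccontr)
    assume "\<not> ?thesis"
    then obtain y' where "y = One # y'" by (cases y; cases "hd y") auto
    with y have "phi w = (Zero # c) @ One # y'" by simp
    then obtain z where "Zero # c = z @ [Zero]" using phi_Zero_before_One by blast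
    then have "last (Zero # c) = Zero" by simp
    then show False using c2 by simp
  qed
  then obtain b where b: "border b w" "phi b = Zero # c"
    using border_phi_of_cuts[OF x' y] by auto
  moreover have "b \<noteq> []" using b(2) by auto
  moreover have "c = remove_zero (phi b)" using b(2) by (simp add: remove_zero_def)
  ultimately show "c \<in> ?R" by blast
next
  fix c assume "c \<in> ?R"
  then obtain b where b: "c = remove_zero (phi b)" "b \<noteq> []" "border b w" by blast
  then obtain x y where w: "w = x @ b" "w = b @ y"
    unfolding border_def by blast
  have pb: "phi b = Zero # c" using b(1,2) phi_begins_with_zero by simp
  \<comment> \<open>This excludes \<open>b = [One]\<close>, whose shortened image would be
    empty.\<close>
  have "hd b = Zero" using w(2) assms(1) b(2) by simp
  then have "c \<noteq> []" using pb b(2) by (cases b) auto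
  moreover have "remove_zero (phi w) = c @ phi y"
    using w(2) pb by (simp add: remove_zero_def)
  moreover have "\<exists>z. remove_zero (phi w) = z @ c"
  proof (cases "x = []")
    case True
    then show ?thesis using w(1) pb by (simp add: remove_zero_def)
  next
    case False
    then have "remove_zero (phi w) = (remove_zero (phi x) @ [Zero]) @ c"
      using w(1) pb by (simp add: remove_zero_def)
    then show ?thesis by blast
  qed
  ultimately show "c \<in> ?L" unfolding border_def by blast
qed

section \<open>Recursions for \<open>fib_word\<close>, \<open>p_word\<close> and
  \<open>M_word\<close>\<close>

lemma phi_fib_word: "n \<ge> 1 \<Longrightarrow> phi (fib_word n) = fib_word (Suc n)"
  by (induction n rule: fib_word.induct) auto

lemma fib_word_eq_p_word:
  "n \<ge> 3 \<Longrightarrow> fib_word n = p_word n @ (if odd n then [Zero, One] else [One, Zero])"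
proof -
  \<comment> \<open>The shift by three flips the parity test. Each word ends with the one two
    indices earlier, so its last two letters depend on parity only.\<close>
  have "\<exists>q. fib_word (Suc (Suc (Suc n))) = q @ (if even n then [Zero, One] else [One, Zero])" for n
  proof (induction n rule: fib_word.induct)
    case (4 n)
    then show ?case
      by (auto split: if_splits)
  qed auto
  moreover assume "n \<ge> 3"
  then obtain m where m: "n = Suc (Suc (Suc m))"
    by (metis Suc_le_D numeral_3_eq_3 Suc_le_mono)
  ultimately obtain q where "fib_word n = q @ (if odd n then [Zero, One] else [One, Zero])"
    by (metis even_Suc)
  then show ?thesis by (simp add: p_word_def butlast_append)
qed

text \<open>The endings 01 and 10 have images 010 and 001; deleting the last two letters leaves a
  single 0 in both cases.\<close>

lemma p_word_Suc:
  assumes "n \<ge> 3" shows "p_word (Suc n) = phi (p_word n) @ [Zero]"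
  using phi_fib_word[of n] fib_word_eq_p_word[of n] fib_word_eq_p_word[of "Suc n"] assms
  by (auto split: if_splits)

lemma M_word_Suc_odd:
  "n \<ge> 3 \<Longrightarrow> odd n \<Longrightarrow> M_word (Suc n) = phi (M_word n) @ [Zero]"
  by (simp add: M_word_def p_word_Suc)

text \<open>Both outer zeros become 01: the first loses its 0, and the 0 of the last completes
  \<open>p_word (Suc n)\<close>.\<close>

lemma M_word_Suc_even:
  "n \<ge> 3 \<Longrightarrow> even n \<Longrightarrow> M_word (Suc n) = remove_zero (phi (M_word n))"
  by (simp add: M_word_def p_word_Suc remove_zero_def)

lemma border_set_Suc_odd:
  assumes "n \<ge> 3" "odd n"
  shows "border_set (Suc n) = {[Zero]} \<union> {phi b @ [Zero] | b. b \<in> border_set n}"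
  using nonempty_borders_phi_Zero[of "M_word n"] M_word_Suc_odd[OF assms]
  by (simp add: border_set_def)

lemma border_set_Suc_even:
  assumes "n \<ge> 3" "even n"
  shows "border_set (Suc n) = {remove_zero (phi b) | b. b \<in> border_set n}"
proof -
  have "hd (M_word n) = Zero" "last (M_word n) = Zero" "M_word n \<noteq> []"
    using assms(2) by (simp_all add: M_word_def)
  from nonempty_borders_remove_zero_phi[OF this] show ?thesis
    using M_word_Suc_even[OF assms] by (simp add: border_set_def)
qed

lemma border_set_3: "border_set 3 = {[One], [One, One]}"
  by (auto simp: border_set_def border_def M_word_examples Cons_eq_append_conv)

theorem theorem2:
  "(\<forall>n\<ge>1.
      border_set (2 * n + 2) = {[Zero]} \<union> {phi b @ [Zero] | b. b \<in> border_set (2 * n + 1)} \<and>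
      border_set (2 * n + 3) = {remove_zero (phi b) | b. b \<in> border_set (2 * n + 2)}) \<and>
   border_set 3 = {[One], [One, One]}"
proof (intro conjI allI impI)
  fix n :: nat assume "n \<ge> 1"
  then show "border_set (2 * n + 2) = {[Zero]} \<union> {phi b @ [Zero] | b. b \<in> border_set (2 * n + 1)}"
    using border_set_Suc_odd[of "2 * n + 1"] by simp
  from \<open>n \<ge> 1\<close> have "border_set (Suc (2 * n + 2)) =
      {remove_zero (phi b) | b. b \<in> border_set (2 * n + 2)}"
    by (intro border_set_Suc_even) simp_all
  moreover have "Suc (2 * n + 2) = 2 * n + 3" by simp
  ultimately show "border_set (2 * n + 3) = {remove_zero (phi b) | b. b \<in> border_set (2 * n + 2)}"
    by (simp only:)
qed (rule border_set_3)

end
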